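(* Absolutely maximally entangled (AME) states of $n$ parties having $D$ levels each do not exist for the following parameters: (i) $D=3$ and $n\in\{8,12,13,14,16,17,19,21,23\}$; (ii) $D=4$ and $n\in\{12,16,20,24,25,26,28,29,30,33,37,39\}$; (iii) $D=5$ and $n\in\{28,32,36,40,44,48\}$. That is, for each such pair $(n,D)$ there is no unit vector $|\psi\rangle\in(\mathbb{C}^D)^{\otimes n}$ such that for every subset $S\subseteq\{1,\dots,n\}$ with $|S|=\lfloor n/2\rfloor$ one has $\operatorname{Tr}_{S^c}(|\psi\rangle\langle\psi|)=D^{-|S|}\,\mathbb{1}_S$.
   Context: For a subset $S\subseteq\{1,\dots,n\}$ of the tensor factors (parties) of $(\mathbb{C}^D)^{\otimes n}$, $S^c$ denotes its complement, $\operatorname{Tr}_{S^c}$ the partial trace over the parties in $S^c$, and $\mathbb{1}_S$ the identity operator on the tensor factors in $S$. A pure state (unit vector) $|\psi\rangle\in(\mathbb{C}^D)^{\otimes n}$ is called absolutely maximally entangled (AME) if all its reductions to $\lfloor n/2\rfloor$ parties are maximally mixed, i.e. proportional to the identity. *)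

theory Defs
  imports "HOL-Analysis.Analysis"
begin

text \<open>
  Parties are natural numbers, and each party has the levels \<open>0, \<dots>, D - 1\<close>. For a finite set
  \<open>P\<close> of parties, the tensor product of the spaces \<open>\<complex>\<^sup>D\<close> over the parties in \<open>P\<close> is represented
  in coordinates with respect to the product basis, whose elements are labelled by the
  configurations \<open>configs D P\<close>. Vectors and operators are identified with their coefficient
  functions and matrices; both are set to \<open>0\<close> outside the configurations, so that equality of
  vectors or operators is equality of functions.
\<close>

type_synonym config = "nat \<Rightarrow> nat"
type_synonym ket = "config \<Rightarrow> complex"
type_synonym operator = "config \<Rightarrow> config \<Rightarrow> complex"

definition configs :: "nat \<Rightarrow> nat set \<Rightarrow> config set" where
  "configs D P = (\<Pi>\<^sub>E i\<in>P. {..<D})"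

definition tensor_space :: "nat \<Rightarrow> nat set \<Rightarrow> ket set" where
  "tensor_space D P = {\<psi>. \<forall>x. x \<notin> configs D P \<longrightarrow> \<psi> x = 0}"

definition pure_state :: "nat \<Rightarrow> nat set \<Rightarrow> ket \<Rightarrow> bool" where
  "pure_state D P \<psi> \<longleftrightarrow>
     \<psi> \<in> tensor_space D P \<and> L2_set (\<lambda>x. cmod (\<psi> x)) (configs D P) = 1"

text \<open>The projector \<open>|\<psi>\<rangle>\<langle>\<psi>|\<close>.\<close>

definition projector :: "ket \<Rightarrow> operator" where
  "projector \<psi> = (\<lambda>x y. \<psi> x * cnj (\<psi> y))"

definition id_op :: "nat \<Rightarrow> nat set \<Rightarrow> operator" where
  "id_op D P = (\<lambda>x y. if x \<in> configs D P \<and> x = y then 1 else 0)"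

text \<open>
  \<open>partial_trace D P T A\<close> traces out the parties in \<open>T \<subseteq> P\<close> of an operator \<open>A\<close> on the parties
  in \<open>P\<close>; the result is an operator on the parties in \<open>P - T\<close>.
\<close>

definition partial_trace :: "nat \<Rightarrow> nat set \<Rightarrow> nat set \<Rightarrow> operator \<Rightarrow> operator" where
  "partial_trace D P T A =
     (\<lambda>x y. if x \<in> configs D (P - T) \<and> y \<in> configs D (P - T)
            then \<Sum>z\<in>configs D T. A (merge (P - T) T (x, z)) (merge (P - T) T (y, z))
            else 0)"

definition is_AME :: "nat \<Rightarrow> nat \<Rightarrow> ket \<Rightarrow> bool" where
  "is_AME n D \<psi> \<longleftrightarrow>
     pure_state D {1..n} \<psi> \<and>
     (\<forall>S. S \<subseteq> {1..n} \<and> card S = n div 2 \<longrightarrow>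
        partial_trace D {1..n} ({1..n} - S) (projector \<psi>) =
        (\<lambda>x y. 1 / of_nat D ^ card S * id_op D S x y))"

end

theory Submission
  imports Defs
begin

text \<open>
  Let \<open>\<Pi>\<^sub>S\<close> be the operator on two copies of the system that exchanges the copies of the
  parties in \<open>S\<close>. The purity of the reduction of \<open>\<psi>\<close> to \<open>S\<close> is
  \<open>\<langle>\<psi> \<otimes> \<psi>|\<Pi>\<^sub>S|\<psi> \<otimes> \<psi>\<rangle>\<close>, and the \<open>\<Pi>\<^sub>S\<close> represent the group of subsets under symmetric
  difference. Averaging them against the character \<open>S \<mapsto> (-1)\<^bsup>|S \<inter> T|\<^esup>\<close> gives an orthogonal projection,
  so that the sum of the purities weighted with these signs is nonnegative (the shadow
  inequality). For an AME state the purities are \<open>D\<^bsup>-min(|S|, n - |S|)\<^esup>\<close>, and the sum is negative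
  for the given parameters when \<open>T\<close> consists of \<open>4 \<lfloor>n/4\<rfloor>\<close> parties.
\<close>

subsection \<open>Configurations\<close>

lemma finite_configs: "finite P \<Longrightarrow> finite (configs D P)"
  by (simp add: configs_def finite_PiE)

lemma override_on_configs:
  "x \<in> configs D P \<Longrightarrow> y \<in> configs D P \<Longrightarrow> override_on x y S \<in> configs D P"
  by (auto simp: configs_def override_on_def PiE_iff extensional_def)

lemma sum_configs_merge:
  assumes "A \<inter> B = {}"
  shows "(\<Sum>x\<in>configs D (A \<union> B). f x) =
         (\<Sum>a\<in>configs D A. \<Sum>b\<in>configs D B. f (merge A B (a, b)))"
proof -
  have "(\<Sum>x\<in>configs D (A \<union> B). f x) =
        (\<Sum>(a, b)\<in>configs D A \<times> configs D B. f (merge A B (a, b)))"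
  proof (rule sum.reindex_bij_witness[where i = "merge A B" and
          j = "\<lambda>x. (restrict x A, restrict x B)"])
    fix x assume "x \<in> configs D (A \<union> B)"
    then show "merge A B (restrict x A, restrict x B) = x"
      by (auto simp: configs_def merge_def PiE_iff extensional_def)
    then show "(case (restrict x A, restrict x B) of (a, b) \<Rightarrow> f (merge A B (a, b))) = f x"
      by simp
  next
    fix p assume "p \<in> configs D A \<times> configs D B"
    then show "(restrict (merge A B p) A, restrict (merge A B p) B) = p"
      using assms by (cases p) (auto simp: configs_def merge_def PiE_iff extensional_def fun_eq_iff)
  qed (auto simp: configs_def merge_def PiE_iff extensional_def split: prod.splits)
  then show ?thesis
    by (simp add: sum.cartesian_product)
qed

lemma card_configs_agreeing:
  assumes "finite A" "S \<subseteq> A" "a \<in> configs D A"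
  shows "card {b \<in> configs D A. \<forall>i\<in>S. b i = a i} = D ^ (card A - card S)"
proof -
  have "{b \<in> configs D A. \<forall>i\<in>S. b i = a i} = (\<Pi>\<^sub>E i\<in>A. if i \<in> S then {a i} else {..<D})"
    using assms(2,3) by (fastforce simp: configs_def PiE_iff extensional_def split: if_splits)
  moreover have "card \<dots> = (\<Prod>i\<in>A. if i \<in> S then 1 else D)"
    using assms(1) by (subst card_PiE) (auto intro!: prod.cong)
  moreover have "\<dots> = D ^ card (A - S)"
    using assms(1,2) by (subst prod.If_cases) (auto simp: Diff_eq Collect_neg_eq)
  ultimately show ?thesis
    using assms(1,2) by (simp add: card_Diff_subset finite_subset)
qed

subsection \<open>Purities and the shadow inequality\<close>

text \<open>The operator \<open>\<Pi>\<^sub>S\<close> permutes the product basis of the two copies,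
  so it is encoded as an involution on pairs of labels.\<close>

definition swap_parties :: "nat set \<Rightarrow> config \<times> config \<Rightarrow> config \<times> config" where
  "swap_parties S p = (override_on (fst p) (snd p) S, override_on (snd p) (fst p) S)"

definition copies :: "ket \<Rightarrow> config \<times> config \<Rightarrow> complex" where
  "copies \<psi> p = \<psi> (fst p) * \<psi> (snd p)"

text \<open>For \<open>S \<subseteq> P\<close>, writing out the trace of the squared reduced matrix
  gives this sum, so no partial trace has to be formed.\<close>

definition purity :: "nat \<Rightarrow> nat set \<Rightarrow> ket \<Rightarrow> nat set \<Rightarrow> complex" where
  "purity D P \<psi> S =
     (\<Sum>p\<in>configs D P \<times> configs D P. copies \<psi> p * cnj (copies \<psi> (swap_parties S p)))"

lemma swap_parties_swap_parties:
  "swap_parties S (swap_parties S' p) = swap_parties (sym_diff S S') p"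
  by (auto simp: swap_parties_def override_on_def)

lemma swap_parties_twice [simp]: "swap_parties S (swap_parties S p) = p"
  by (cases p) (simp add: swap_parties_def override_on_def fun_eq_iff)

lemma swap_parties_configs:
  "p \<in> configs D P \<times> configs D P \<Longrightarrow> swap_parties S p \<in> configs D P \<times> configs D P"
  by (auto simp: swap_parties_def override_on_configs)

definition party_sign :: "nat set \<Rightarrow> nat set \<Rightarrow> int" where
  "party_sign T S = (\<Prod>i\<in>S. if i \<in> T then - 1 else 1)"

text \<open>A party in both sets contributes the square of a sign, which is 1, just like a party in
  neither.\<close>

lemma party_sign_sym_diff:
  assumes "finite S" "finite S'"
  shows "party_sign T (sym_diff S S') = party_sign T S * party_sign T S'"
proof -
  \<comment> \<open>Over a common index set the three products can be compared factor by
    factor.\<close>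
  have extend: "party_sign T R = (\<Prod>i\<in>S \<union> S'. if i \<in> R \<and> i \<in> T then - 1 else 1)"
    if "R \<subseteq> S \<union> S'" for R
    unfolding party_sign_def using that assms by (intro prod.mono_neutral_cong_left) auto
  show ?thesis
    by (subst (1 2 3) extend) (auto simp flip: prod.distrib intro!: prod.cong)
qed

text \<open>Up to the factor \<open>2 ^ card P\<close>, the vector \<open>\<Phi>\<close> is the
  projection of the two copies of \<open>\<psi>\<close> onto a joint eigenspace of the swaps. Its
  squared norm is \<open>2 ^ card P\<close> times the signed sum.\<close>

lemma shadow_inequality:
  assumes "finite P"
  shows "0 \<le> Re (\<Sum>S\<in>Pow P. of_int (party_sign T S) * purity D P \<psi> S)"
proof -
  let ?C = "configs D P \<times> configs D P"
  let ?\<chi> = "\<lambda>S. complex_of_int (party_sign T S)"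
  define \<Phi> where "\<Phi> p = (\<Sum>S\<in>Pow P. ?\<chi> S * copies \<psi> (swap_parties S p))" for p
  \<comment> \<open>Substituting \<open>swap_parties S p\<close> for \<open>p\<close> moves both
    swaps into the second factor, where they combine.\<close>
  have overlap: "(\<Sum>p\<in>?C. copies \<psi> (swap_parties S p) * cnj (copies \<psi> (swap_parties S' p)))
      = purity D P \<psi> (sym_diff S S')" for S S'
    unfolding purity_def
  proof (rule sum.reindex_bij_witness[where i = "swap_parties S" and j = "swap_parties S"])
    fix p
    have "swap_parties (sym_diff S S') (swap_parties S p) = swap_parties S' p"
      by (simp add: swap_parties_swap_parties)
         (auto intro!: arg_cong2[where f = swap_parties])
    then show "copies \<psi> (swap_parties S p) *
        cnj (copies \<psi> (swap_parties (sym_diff S S') (swap_parties S p))) =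
        copies \<psi> (swap_parties S p) * cnj (copies \<psi> (swap_parties S' p))"
      by simp
  qed (simp_all add: swap_parties_configs del: mem_Sigma_iff)
  have "(\<Sum>p\<in>?C. \<Phi> p * cnj (\<Phi> p)) =
      (\<Sum>p\<in>?C. \<Sum>S\<in>Pow P. \<Sum>S'\<in>Pow P. ?\<chi> S * ?\<chi> S' *
         (copies \<psi> (swap_parties S p) * cnj (copies \<psi> (swap_parties S' p))))"
    by (simp add: \<Phi>_def sum_product mult_ac)
  also have "\<dots> = (\<Sum>S\<in>Pow P. \<Sum>S'\<in>Pow P. ?\<chi> S * ?\<chi> S' * purity D P \<psi> (sym_diff S S'))"
    by (subst sum.swap, intro sum.cong refl, subst sum.swap)
       (simp add: sum_distrib_left flip: overlap)
  also have "\<dots> = (\<Sum>S\<in>Pow P. \<Sum>S'\<in>Pow P. ?\<chi> (sym_diff S S') * purity D P \<psi> (sym_diff S S'))"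
    using assms
    by (intro sum.cong refl) (simp add: party_sign_sym_diff finite_subset)
  \<comment> \<open>For fixed \<open>S\<close>, the map \<open>sym_diff S\<close> is a bijection of
    \<open>Pow P\<close>, so the inner sum does not depend on \<open>S\<close>.\<close>
  also have "\<dots> = (\<Sum>S\<in>Pow P. \<Sum>R\<in>Pow P. ?\<chi> R * purity D P \<psi> R)"
  proof (rule sum.cong[OF refl])
    fix S assume "S \<in> Pow P"
    then show "(\<Sum>S'\<in>Pow P. ?\<chi> (sym_diff S S') * purity D P \<psi> (sym_diff S S')) =
        (\<Sum>R\<in>Pow P. ?\<chi> R * purity D P \<psi> R)"
      by (intro sum.reindex_bij_witness[where i = "sym_diff S" and j = "sym_diff S"]) auto
  qed
  also have "\<dots> = of_nat (2 ^ card P) * (\<Sum>R\<in>Pow P. ?\<chi> R * purity D P \<psi> R)"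
    using assms by (simp add: card_Pow)
  finally have "(\<Sum>p\<in>?C. (cmod (\<Phi> p))\<^sup>2) =
      2 ^ card P * Re (\<Sum>R\<in>Pow P. ?\<chi> R * purity D P \<psi> R)"
    by (simp add: complex_norm_square[symmetric] complex_eq_iff flip: of_real_sum)
  moreover have "0 \<le> (\<Sum>p\<in>?C. (cmod (\<Phi> p))\<^sup>2)"
    by (simp add: sum_nonneg)
  moreover have "(2::real) ^ card P > 0"
    by simp
  ultimately show ?thesis
    by (metis zero_le_mult_iff not_less)
qed

subsection \<open>Purities of an AME state\<close>

text \<open>Swapping \<open>P - S\<close> instead of \<open>S\<close> yields the same pair with its
  entries exchanged, and \<open>copies \<psi>\<close> is symmetric.\<close>

lemma purity_Compl:
  assumes "S \<subseteq> P"
  shows "purity D P \<psi> (P - S) = purity D P \<psi> S"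
proof -
  have "copies \<psi> (swap_parties (P - S) (x, y)) = copies \<psi> (swap_parties S (x, y))"
    if "x \<in> configs D P" "y \<in> configs D P" for x y
  proof -
    have "override_on x y (P - S) = override_on y x S" "override_on y x (P - S) = override_on x y S"
      using that by (auto simp: override_on_def configs_def PiE_iff extensional_def fun_eq_iff)
    then show ?thesis
      by (simp add: copies_def swap_parties_def)
  qed
  then show ?thesis
    unfolding purity_def by (intro sum.cong) auto
qed

text \<open>The reduction to \<open>A\<close> determines the purities of all subsets of
  \<open>A\<close>. There are \<open>D ^ card A\<close> choices of \<open>a\<close> and
  \<open>D ^ (card A - card S)\<close> choices of \<open>b\<close> agreeing with \<open>a\<close> on
  \<open>S\<close>; each pair contributes the square of the diagonal entry
  \<open>1 / D ^ card A\<close>.\<close>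

lemma purity_maximally_mixed:
  assumes "finite P" "A \<subseteq> P" "S \<subseteq> A" "D > 0"
    and mixed: "partial_trace D P (P - A) (projector \<psi>) =
                (\<lambda>x y. 1 / of_nat D ^ card A * id_op D A x y)"
  shows "purity D P \<psi> S = 1 / of_nat D ^ card S"
proof -
  let ?B = "P - A"
  let ?m = "\<lambda>a z. \<psi> (merge A ?B (a, z))"
  have fin: "finite A" "finite S"
    using assms(1-3) by (auto intro: finite_subset)
  have card_le: "card S \<le> card A"
    using assms(3) fin by (simp add: card_mono)
  have P: "P = A \<union> ?B" and PA: "P - ?B = A"
    using assms(2) by auto
  have reduced: "(\<Sum>z\<in>configs D ?B. ?m a z * cnj (?m a' z)) = (if a = a' then 1 / of_nat D ^ card A else 0)"
    if "a \<in> configs D A" "a' \<in> configs D A" for a a'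
    using fun_cong[OF fun_cong[OF mixed, of a], of a'] that
    by (simp add: partial_trace_def PA projector_def id_op_def)
  \<comment> \<open>As \<open>S \<subseteq> A\<close>, the swap leaves the parts \<open>z\<close>
    and \<open>w\<close> outside \<open>A\<close> in place.\<close>
  have override: "override_on (merge A ?B (a, z)) (merge A ?B (b, w)) S = merge A ?B (override_on a b S, z)"
    for a b z w
    using assms(3) by (auto simp: override_on_def merge_def fun_eq_iff)
  have "purity D P \<psi> S = (\<Sum>x\<in>configs D P. \<Sum>y\<in>configs D P.
      copies \<psi> (x, y) * cnj (copies \<psi> (swap_parties S (x, y))))"
    by (simp add: purity_def sum.cartesian_product)
  also have "\<dots> = (\<Sum>a\<in>configs D A. \<Sum>z\<in>configs D ?B. \<Sum>b\<in>configs D A. \<Sum>w\<in>configs D ?B.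
      (?m a z * cnj (?m (override_on a b S) z)) * (?m b w * cnj (?m (override_on b a S) w)))"
    by (subst (1 2) P, subst (1 2) sum_configs_merge)
       (simp_all add: copies_def swap_parties_def override mult_ac)
  \<comment> \<open>Now \<open>z\<close> and \<open>w\<close> occur in separate factors, each an
    entry of the reduced matrix on \<open>A\<close>.\<close>
  also have "\<dots> = (\<Sum>a\<in>configs D A. \<Sum>b\<in>configs D A.
      (\<Sum>z\<in>configs D ?B. ?m a z * cnj (?m (override_on a b S) z)) *
      (\<Sum>w\<in>configs D ?B. ?m b w * cnj (?m (override_on b a S) w)))"
    by (rule sum.cong[OF refl], subst sum.swap) (simp add: sum_product)
  also have "\<dots> = (\<Sum>a\<in>configs D A. \<Sum>b\<in>configs D A.
      if \<forall>i\<in>S. b i = a i then 1 / of_nat D ^ (2 * card A) else 0)"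
  proof (intro sum.cong refl)
    fix a b assume ab: "a \<in> configs D A" "b \<in> configs D A"
    \<comment> \<open>The two entries are diagonal under the same condition, so both survive or both
      vanish.\<close>
    have "a = override_on a b S \<longleftrightarrow> (\<forall>i\<in>S. b i = a i)" "b = override_on b a S \<longleftrightarrow> (\<forall>i\<in>S. b i = a i)"
      by (auto simp: override_on_def fun_eq_iff)
    then show "(\<Sum>z\<in>configs D ?B. ?m a z * cnj (?m (override_on a b S) z)) *
      (\<Sum>w\<in>configs D ?B. ?m b w * cnj (?m (override_on b a S) w)) =
      (if \<forall>i\<in>S. b i = a i then 1 / of_nat D ^ (2 * card A) else 0)"
      using ab by (simp add: reduced override_on_configs mult_2 power_add)
  qed
  also have "\<dots> = (\<Sum>a\<in>configs D A. of_nat D ^ (card A - card S) / of_nat D ^ (2 * card A))"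
    using fin(1) assms(3)
    by (intro sum.cong refl)
       (simp add: sum.If_cases finite_configs Int_def conj_commute card_configs_agreeing)
  also have "\<dots> = of_nat D ^ card A * of_nat D ^ (card A - card S) / of_nat D ^ (2 * card A)"
    using fin(1) by (simp add: configs_def card_PiE)
  also have "\<dots> = 1 / of_nat D ^ card S"
    using \<open>D > 0\<close> card_le
    by (simp add: divide_simps mult_2 flip: power_add)
  finally show ?thesis .
qed

text \<open>A set of at most \<open>n div 2\<close> parties extends to one of exactly that size,
  whose reduction is maximally mixed; a larger set has a complement of at most that size, for odd
  \<open>n\<close> too.\<close>

lemma purity_AME:
  assumes "is_AME n D \<psi>" "D > 0" "S \<subseteq> {1..n}"
  shows "purity D {1..n} \<psi> S = 1 / of_nat D ^ min (card S) (n - card S)"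
proof -
  have small: "purity D {1..n} \<psi> R = 1 / of_nat D ^ card R"
    if R: "R \<subseteq> {1..n}" "card R \<le> n div 2" for R
  proof -
    obtain A where "R \<subseteq> A" "A \<subseteq> {1..n}" "card A = n div 2"
      using exists_subset_between[of R "n div 2" "{1..n}"] R by auto
    then show ?thesis
      using assms(1,2) by (intro purity_maximally_mixed[of _ A]) (auto simp: is_AME_def)
  qed
  have card: "card ({1..n} - S) = n - card S"
    using assms(3) by (simp add: card_Diff_subset finite_subset)
  show ?thesis
  proof (cases "card S \<le> n div 2")
    case True
    then show ?thesis
      using small[OF assms(3)] by (simp add: min_def)
  next
    case False
    then have "n - card S \<le> n div 2" "n - card S \<le> card S"
      by linarith+
    then show ?thesis
      using small[of "{1..n} - S"] card purity_Compl[OF assms(3)] by (simp add: min_def)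
  qed
qed

subsection \<open>The signed sum over all sets of parties\<close>

text \<open>
  The list holds the values, by cardinality, of a function of sets of parties. Summing over the
  membership of one party turns it into its list of consecutive differences or sums, so that a
  sum over \<open>2\<^sup>n\<close> sets is computed in \<open>n\<^sup>2\<close> steps.
\<close>

fun signed_sum :: "nat \<Rightarrow> nat \<Rightarrow> int list \<Rightarrow> int" where
  "signed_sum t 0 xs = hd xs"
| "signed_sum t (Suc n) xs =
     signed_sum t n (map2 (if n < t then (-) else (+)) xs (tl xs))"

lemma sum_party_sign:
  assumes "length xs = Suc n"
  shows "(\<Sum>S\<in>Pow {1..n}. party_sign {1..t} S * xs ! card S) = signed_sum t n xs"
  using assms
proof (induction n arbitrary: xs)
  case 0
  then show ?case
    by (cases xs) (auto simp: party_sign_def)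
next
  case (Suc n)
  let ?ys = "map2 (if n < t then (-) else (+)) xs (tl xs)"
  \<comment> \<open>The party being split off is \<open>Suc n\<close>, which lies in
    \<open>{1..t}\<close> exactly when \<open>n < t\<close>.\<close>
  have ins: "party_sign {1..t} (insert (Suc n) S) * xs ! card (insert (Suc n) S) =
      (if n < t then - 1 else 1) * party_sign {1..t} S * xs ! Suc (card S)" if "S \<subseteq> {1..n}" for S
  proof -
    have "finite S" "Suc n \<notin> S"
      using that by (auto intro: finite_subset)
    then show ?thesis
      by (simp add: party_sign_def)
  qed
  have ys: "?ys ! card S = xs ! card S + (if n < t then - 1 else 1) * xs ! Suc (card S)"
    if "S \<subseteq> {1..n}" for S
  proof -
    have "card S \<le> n"
      using card_mono[OF _ that] by simp
    then show ?thesis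
      using Suc.prems by (simp add: nth_tl)
  qed
  have "(\<Sum>S\<in>Pow {1..Suc n}. party_sign {1..t} S * xs ! card S) =
      (\<Sum>S\<in>Pow {1..n}. party_sign {1..t} S * xs ! card S) +
      (\<Sum>S\<in>Pow {1..n}. party_sign {1..t} (insert (Suc n) S) * xs ! card (insert (Suc n) S))"
  proof -
    have new: "Suc n \<notin> S" if "S \<in> Pow {1..n}" for S
      using that by auto
    have "inj_on (insert (Suc n)) (Pow {1..n})"
      using new by (metis inj_onI insert_ident)
    moreover have "Pow {1..n} \<inter> insert (Suc n) ` Pow {1..n} = {}"
      using new by blast
    moreover have "Pow {1..Suc n} = Pow {1..n} \<union> insert (Suc n) ` Pow {1..n}"
      by (simp add: atLeastAtMostSuc_conv Pow_insert)
    ultimately show ?thesis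
      by (simp add: sum.union_disjoint sum.reindex del: Pow_iff)
  qed
  also have "\<dots> = (\<Sum>S\<in>Pow {1..n}. party_sign {1..t} S * ?ys ! card S)"
    unfolding sum.distrib[symmetric]
    by (intro sum.cong refl) (simp only: ins ys Pow_iff, simp only: ring_distribs mult_ac)
  also have "\<dots> = signed_sum t n ?ys"
    using Suc.prems by (intro Suc.IH) simp
  finally show ?case
    by simp
qed

text \<open>The factor \<open>D ^ n\<close> clears all denominators of the AME purities, so the
  signed sum can be evaluated exactly in integers.\<close>

definition scaled_purities :: "nat \<Rightarrow> nat \<Rightarrow> int list" where
  "scaled_purities D n = map (\<lambda>k. int D ^ (n - min k (n - k))) [0..<Suc n]"

text \<open>This is the shadow inequality for \<open>T = {1..t}\<close>, multiplied by
  \<open>D ^ n\<close>.\<close>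

lemma signed_sum_AME_nonneg:
  assumes "is_AME n D \<psi>" "D > 0"
  shows "0 \<le> signed_sum t n (scaled_purities D n)"
proof -
  let ?xs = "scaled_purities D n"
  have scaled: "real_of_int (?xs ! card S) = real D ^ n * Re (purity D {1..n} \<psi> S)"
    if "S \<subseteq> {1..n}" for S
  proof -
    let ?m = "min (card S) (n - card S)"
    have "card S \<le> n"
      using card_mono[OF _ that] by simp
    then have "?xs ! card S = int D ^ (n - ?m)"
      by (simp add: scaled_purities_def nth_append)
    moreover have "real D ^ (n - ?m) = real D ^ n * (1 / real D ^ ?m)"
      using assms(2) \<open>card S \<le> n\<close> by (subst power_diff) auto
    moreover have "Re (1 / of_nat D ^ ?m) = 1 / real D ^ ?m"
      by (metis Re_complex_of_real of_real_1 of_real_divide of_real_of_nat_eq of_real_power)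
    ultimately show ?thesis
      by (simp only: purity_AME[OF assms that] of_int_power of_int_of_nat_eq)
  qed
  have "real_of_int (signed_sum t n ?xs) =
      (\<Sum>S\<in>Pow {1..n}. real_of_int (party_sign {1..t} S) * real_of_int (?xs ! card S))"
    by (subst sum_party_sign[symmetric]) (simp_all add: scaled_purities_def)
  also have "\<dots> = (\<Sum>S\<in>Pow {1..n}.
      real D ^ n * (real_of_int (party_sign {1..t} S) * Re (purity D {1..n} \<psi> S)))"
    by (intro sum.cong refl) (simp only: scaled Pow_iff mult_ac)
  also have "\<dots> = real D ^ n * Re (\<Sum>S\<in>Pow {1..n}.
      of_int (party_sign {1..t} S) * purity D {1..n} \<psi> S)"
    by (simp add: sum_distrib_left)
  also have "\<dots> \<ge> 0"
    by (intro mult_nonneg_nonneg shadow_inequality) simp_all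
  finally show ?thesis
    by simp
qed

text \<open>For each listed pair this is the evaluation of one explicit integer, by repeated
  differences and sums of a list of \<open>n + 1\<close> entries.\<close>

lemma signed_sum_negative:
  assumes "(D = 3 \<and> n \<in> {8, 12, 13, 14, 16, 17, 19, 21, 23}) \<or>
           (D = 4 \<and> n \<in> {12, 16, 20, 24, 25, 26, 28, 29, 30, 33, 37, 39}) \<or>
           (D = 5 \<and> n \<in> {28, 32, 36, 40, 44, 48})"
  shows "signed_sum (4 * (n div 4)) n (scaled_purities D n) < 0"
proof -
  have "\<forall>n\<in>{8, 12, 13, 14, 16, 17, 19, 21, 23}.
      signed_sum (4 * (n div 4)) n (scaled_purities 3 n) < 0"
    by code_simp
  moreover have "\<forall>n\<in>{12, 16, 20, 24, 25, 26, 28, 29, 30, 33, 37, 39}.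
      signed_sum (4 * (n div 4)) n (scaled_purities 4 n) < 0"
    by code_simp
  moreover have "\<forall>n\<in>{28, 32, 36, 40, 44, 48}.
      signed_sum (4 * (n div 4)) n (scaled_purities 5 n) < 0"
    by code_simp
  ultimately show ?thesis
    using assms by blast
qed

theorem mainTheorem1:
  fixes n D :: nat
  assumes "(D = 3 \<and> n \<in> {8, 12, 13, 14, 16, 17, 19, 21, 23}) \<or>
           (D = 4 \<and> n \<in> {12, 16, 20, 24, 25, 26, 28, 29, 30, 33, 37, 39}) \<or>
           (D = 5 \<and> n \<in> {28, 32, 36, 40, 44, 48})"
  shows "\<not> (\<exists>\<psi>. is_AME n D \<psi>)"
proof
  assume "\<exists>\<psi>. is_AME n D \<psi>"
  then obtain \<psi> where "is_AME n D \<psi>" ..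
  moreover have "D > 0"
    using assms by auto
  ultimately show False
    using signed_sum_AME_nonneg signed_sum_negative[OF assms] by (metis not_less)
qed

end
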